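(* Let $R$ be a noetherian domain of dimension $1$, $I=(f_1,\ldots,f_n)\neq 0$ an ideal of $R$, $f\in R$, and let $A=R[T_1,\ldots,T_n]/(f_1T_1+\cdots+f_nT_n+f)$ be the forcing algebra for these data. Let $H=V(\mathfrak p)$ be the horizontal component of $\operatorname{Spec} A$ and let $V_j=V(\mathfrak q_j)$, $j\in J$, be the vertical components of $\operatorname{Spec} A$. Then $\operatorname{Spec} A$ is connected if and only if $H$ intersects every $V_j$.
   Context: The empty topological space is not considered connected. Prime ideals of $R[T_1,\ldots,T_n]$ minimal over $(f_1T_1+\cdots+f_nT_n+f)$ are identified with the minimal prime ideals of $A$. For a noetherian domain $R$ and $I\neq 0$, there is a unique irreducible component $H$ of $\operatorname{Spec} A$ whose image in $\operatorname{Spec} R$ is dense; it is called the horizontal component and is given by the prime ideal $\mathfrak p=R[T_1,\ldots,T_n]\cap (f_1T_1+\cdots+f_nT_n+f)\,Q(R)[T_1,\ldots,T_n]$, where $Q(R)$ is the quotient field of $R$. All other irreducible components of $\operatorname{Spec} A$ are called vertical components; each is of the form $V(\mathfrak q R[T_1,\ldots,T_n])$ (viewed in $\operatorname{Spec} A$) for a prime ideal $\mathfrak q$ of $R$ minimal over $(f_1,\ldots,f_n,f)$, and $V(\mathfrak q_j)$ is shorthand for this closed subset of $\operatorname{Spec} A$. *)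

theory Defs
  imports
    "HOL-Analysis.Abstract_Topology"
    "HOL-Algebra.Algebra"
    "HOL-Algebra.Algebraic_Closure_Type"
    "HOL-Computational_Algebra.Fraction_Field"
    "HOL-Library.Poly_Mapping"
    "HOL-Library.Extended_Nat"
begin

section \<open>Prime spectrum and Krull dimension\<close>

definition Spec :: "('a, 'b) ring_scheme \<Rightarrow> 'a set set" where
  "Spec R = {P. primeideal P R}"

definition zeros :: "('a, 'b) ring_scheme \<Rightarrow> 'a set \<Rightarrow> 'a set set" where
  "zeros R S = {P \<in> Spec R. S \<subseteq> P}"

definition zariski :: "('a, 'b) ring_scheme \<Rightarrow> 'a set topology" where
  "zariski R = topology (\<lambda>U. \<exists>S \<subseteq> carrier R. U = Spec R - zeros R S)"

lemma zeros_Un: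
  assumes S: "S \<subseteq> carrier R" and T: "T \<subseteq> carrier R"
  shows "zeros R S \<union> zeros R T = zeros R {s \<otimes>\<^bsub>R\<^esub> t | s t. s \<in> S \<and> t \<in> T}" (is "?L = ?M")
proof
  show "?L \<subseteq> ?M"
  proof
    fix P assume P: "P \<in> ?L"
    then have pr: "primeideal P R" by (auto simp: zeros_def Spec_def)
    interpret primeideal P R by (fact pr)
    have "s \<otimes>\<^bsub>R\<^esub> t \<in> P" if "s \<in> S" "t \<in> T" for s t
      using P that S T I_l_closed I_r_closed unfolding zeros_def by blast
    then show "P \<in> ?M" using pr by (auto simp: zeros_def Spec_def)
  qed
  show "?M \<subseteq> ?L"
  proof
    fix P assume P: "P \<in> ?M"
    then have pr: "primeideal P R" by (auto simp: zeros_def Spec_def)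
    interpret primeideal P R by (fact pr)
    have "T \<subseteq> P" if s: "s \<in> S" "s \<notin> P" for s
    proof
      fix t assume t: "t \<in> T"
      have "s \<otimes>\<^bsub>R\<^esub> t \<in> P" using P s t by (auto simp: zeros_def)
      then show "t \<in> P" using I_prime s t S T by blast
    qed
    then show "P \<in> ?L" using pr by (auto simp: zeros_def Spec_def)
  qed
qed

lemma istopology_zariski:
  "istopology (\<lambda>U. \<exists>S \<subseteq> carrier R. U = Spec R - zeros R S)"
  unfolding istopology_def
proof safe
  fix S T assume S: "S \<subseteq> carrier R" and T: "T \<subseteq> carrier R"
  define W where "W = {s \<otimes>\<^bsub>R\<^esub> t | s t. s \<in> S \<and> t \<in> T} \<inter> carrier R"
  have W: "zeros R W = zeros R S \<union> zeros R T"
  proof (cases "Spec R = {}")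
    case True
    then show ?thesis by (auto simp: zeros_def)
  next
    case False
    then obtain P where "primeideal P R" by (auto simp: Spec_def)
    then interpret primeideal P R .
    have "W = {s \<otimes>\<^bsub>R\<^esub> t | s t. s \<in> S \<and> t \<in> T}"
      using S T by (auto simp: W_def)
    then show ?thesis using zeros_Un[OF S T] by simp
  qed
  show "\<exists>S'\<subseteq>carrier R. (Spec R - zeros R S) \<inter> (Spec R - zeros R T) = Spec R - zeros R S'"
    by (rule exI[of _ W]) (use W in \<open>auto simp: W_def\<close>)
next
  fix K assume K: "\<forall>U\<in>K. \<exists>S\<subseteq>carrier R. U = Spec R - zeros R S"
  then have "\<forall>U\<in>K. \<exists>S. S \<subseteq> carrier R \<and> U = Spec R - zeros R S" by simp
  then obtain g where g: "\<forall>U\<in>K. g U \<subseteq> carrier R \<and> U = Spec R - zeros R (g U)"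
    by (rule bchoice[THEN exE])
  have "(\<Union>U\<in>K. U) = (\<Union>U\<in>K. Spec R - zeros R (g U))"
    by (rule SUP_cong[OF refl]) (rule g[rule_format, THEN conjunct2])
  also have "\<dots> = Spec R - zeros R (\<Union>(g ` K))" by (auto simp: zeros_def)
  finally have "\<Union>K = Spec R - zeros R (\<Union>(g ` K))" by simp
  moreover have "\<Union>(g ` K) \<subseteq> carrier R"
    by (rule UN_least) (rule g[rule_format, THEN conjunct1])
  ultimately show "\<exists>S\<subseteq>carrier R. \<Union>K = Spec R - zeros R S" by blast
qed

lemma openin_zariski:
  "openin (zariski R) U \<longleftrightarrow> (\<exists>S \<subseteq> carrier R. U = Spec R - zeros R S)"
  unfolding zariski_def topology_inverse'[OF istopology_zariski] ..

lemma topspace_zariski: "topspace (zariski R) = Spec R"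
proof
  show "topspace (zariski R) \<subseteq> Spec R"
    by (auto simp: topspace_def openin_zariski)
  have "zeros R (carrier R) = {}"
  proof -
    have "\<not> carrier R \<subseteq> P" if "primeideal P R" for P
    proof -
      interpret primeideal P R by (fact that)
      show ?thesis using I_notcarr a_subset by blast
    qed
    then show ?thesis by (auto simp: zeros_def Spec_def)
  qed
  then have "openin (zariski R) (Spec R)"
    unfolding openin_zariski by (intro exI[of _ "carrier R"]) simp
  then show "Spec R \<subseteq> topspace (zariski R)" by (rule openin_subset)
qed

lemma closedin_zariski:
  "closedin (zariski R) C \<longleftrightarrow> (\<exists>S \<subseteq> carrier R. C = zeros R S)"
proof -
  have *: "zeros R S \<subseteq> Spec R" for S by (auto simp: zeros_def)
  show ?thesis
    unfolding closedin_def topspace_zariski openin_zariski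
  proof
    assume C: "C \<subseteq> Spec R \<and> (\<exists>S\<subseteq>carrier R. Spec R - C = Spec R - zeros R S)"
    then obtain S where S: "S \<subseteq> carrier R" "Spec R - C = Spec R - zeros R S" by blast
    then have "C = zeros R S" using C *[of S] by blast
    then show "\<exists>S\<subseteq>carrier R. C = zeros R S" using S(1) by blast
  qed (use * in blast)
qed

text \<open>The supremum is taken in \<^typ>\<open>enat\<close>, so the zero ring gets dimension 0 here rather
  than \<open>- \<infinity>\<close>.\<close>

definition krull_dim :: "('a, 'b) ring_scheme \<Rightarrow> enat" where
  "krull_dim R = Sup {enat n | n. \<exists>P :: nat \<Rightarrow> 'a set.
     (\<forall>i\<le>n. primeideal (P i) R) \<and> (\<forall>i<n. P i \<subset> P (Suc i))}"


section \<open>Connectedness and irreducible components\<close>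

text \<open>Unlike \<^const>\<open>connected_space\<close>, this excludes the empty space.\<close>

definition connected_nonempty :: "'a topology \<Rightarrow> bool" where
  "connected_nonempty Y \<longleftrightarrow> topspace Y \<noteq> {} \<and> connected_space Y"

definition irreducible_in :: "'a topology \<Rightarrow> 'a set \<Rightarrow> bool" where
  "irreducible_in Y S \<longleftrightarrow> S \<subseteq> topspace Y \<and> S \<noteq> {} \<and>
     (\<forall>C D. closedin Y C \<and> closedin Y D \<and> S \<subseteq> C \<union> D \<longrightarrow> S \<subseteq> C \<or> S \<subseteq> D)"

definition irreducible_components :: "'a topology \<Rightarrow> 'a set set" where
  "irreducible_components Y =
     {S. irreducible_in Y S \<and> (\<forall>T. irreducible_in Y T \<and> S \<subseteq> T \<longrightarrow> T = S)}"


section \<open>Forcing algebras\<close>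

text \<open>\<open>R[T\<^sub>1, \<dots>, T\<^sub>n]\<close>, with the variables indexed by a finite type of
  cardinality \<open>n\<close>; a monomial is its exponent vector.\<close>

type_synonym ('n, 'a) mpoly = "('n \<Rightarrow>\<^sub>0 nat) \<Rightarrow>\<^sub>0 'a"

definition mpoly_const :: "'a::comm_ring_1 \<Rightarrow> ('n, 'a) mpoly" where
  "mpoly_const a = Poly_Mapping.single 0 a"

definition mpoly_var :: "'n \<Rightarrow> ('n, 'a::comm_ring_1) mpoly" where
  "mpoly_var i = Poly_Mapping.single (Poly_Mapping.single i 1) 1"

definition forcing_poly :: "('n::finite \<Rightarrow> 'a::comm_ring_1) \<Rightarrow> 'a \<Rightarrow> ('n, 'a) mpoly" where
  "forcing_poly fs f = (\<Sum>i\<in>UNIV. mpoly_const (fs i) * mpoly_var i) + mpoly_const f"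

definition forcing_ideal :: "('n::finite \<Rightarrow> 'a::comm_ring_1) \<Rightarrow> 'a \<Rightarrow> ('n, 'a) mpoly set" where
  "forcing_ideal fs f = genideal ring_of_type_algebra {forcing_poly fs f}"

definition forcing_algebra ::
    "('n::finite \<Rightarrow> 'a::comm_ring_1) \<Rightarrow> 'a \<Rightarrow> ('n, 'a) mpoly set ring" where
  "forcing_algebra fs f = ring_of_type_algebra Quot forcing_ideal fs f"

text \<open>The closed subset of \<open>Spec A\<close> cut out by a set \<open>S\<close> of polynomials, i.e.\ by the
  residue classes of its elements.\<close>

definition forcing_zeros ::
    "('n::finite \<Rightarrow> 'a::comm_ring_1) \<Rightarrow> 'a \<Rightarrow> ('n, 'a) mpoly set \<Rightarrow> ('n, 'a) mpoly set set set" where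
  "forcing_zeros fs f S =
     zeros (forcing_algebra fs f)
       ((\<lambda>g. forcing_ideal fs f +>\<^bsub>ring_of_type_algebra\<^esub> g) ` S)"

definition mpoly_to_fract :: "('n, 'a::idom) mpoly \<Rightarrow> ('n, 'a fract) mpoly" where
  "mpoly_to_fract = Poly_Mapping.map (\<lambda>a. Fraction_Field.Fract a 1)"

text \<open>The contraction to \<open>R[T\<^sub>1, \<dots>, T\<^sub>n]\<close> of the ideal generated by the forcing
  polynomial in \<open>Q(R)[T\<^sub>1, \<dots>, T\<^sub>n]\<close>.\<close>

definition horizontal_prime :: "('n::finite \<Rightarrow> 'a::idom) \<Rightarrow> 'a \<Rightarrow> ('n, 'a) mpoly set" where
  "horizontal_prime fs f =
     {g. mpoly_to_fract g \<in> genideal ring_of_type_algebra {mpoly_to_fract (forcing_poly fs f)}}"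

definition horizontal_component ::
    "('n::finite \<Rightarrow> 'a::idom) \<Rightarrow> 'a \<Rightarrow> ('n, 'a) mpoly set set set" where
  "horizontal_component fs f = forcing_zeros fs f (horizontal_prime fs f)"

definition vertical_components ::
    "('n::finite \<Rightarrow> 'a::idom) \<Rightarrow> 'a \<Rightarrow> ('n, 'a) mpoly set set set set" where
  "vertical_components fs f =
     irreducible_components (zariski (forcing_algebra fs f)) - {horizontal_component fs f}"

end

theory Submission
  imports Defs
begin

text \<open>
  Write \<open>B = R[T\<^sub>1, \<dots>, T\<^sub>n]\<close>, let \<open>F\<close> be the forcing polynomial and \<open>\<pp>\<close> the horizontal prime,
  and identify the points of \<open>Spec A\<close> with the primes \<open>P\<close> of \<open>B\<close> that contain \<open>F\<close>.  The theorem
  rests on a decomposition \<open>Spec A = H \<union> V(\<qq>\<^sub>1 B) \<union> \<dots> \<union> V(\<qq>\<^sub>r B)\<close>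
  into finitely many irreducible closed sets, in which the sets \<open>V(\<qq>\<^sub>j B)\<close> are pairwise disjoint.
  Given such a decomposition the rest is topology (\<open>connected_iff_components_meet\<close>).  A vertical
  component has to be one of the \<open>V(\<qq>\<^sub>j B)\<close>; if it misses \<open>H\<close>, then it and the union of the other
  pieces are complementary closed sets and \<open>Spec A\<close> is disconnected.  Conversely, a piece
  \<open>V(\<qq>\<^sub>j B)\<close> either is contained in \<open>H\<close> or is a vertical component, so if \<open>H\<close> meets every vertical
  component, it meets every piece.  In a splitting of \<open>Spec A\<close> into two disjoint closed sets each piece
  lies on one side, which is then the side of \<open>H\<close>, and nothing is left for the other side.

  The decomposition comes from a case distinction on a prime \<open>P\<close> that contains \<open>F\<close>.

  If some \<open>f\<^sub>i\<close> is not in \<open>P\<close>, then \<open>P\<close> contains \<open>\<pp>\<close> (\<open>horizontal_prime_subset\<close>).  The reason is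
  that \<open>F\<close> has degree one in \<open>T\<^sub>i\<close> with leading coefficient \<open>f\<^sub>i\<close>, so every \<open>g\<close> in \<open>B\<close> can be
  pseudo-divided: \<open>f\<^sub>i\<^sup>N g = h F + r\<close> with \<open>r\<close> free of \<open>T\<^sub>i\<close>.  A nonzero multiple of \<open>F\<close> always involves
  \<open>T\<^sub>i\<close>, hence \<open>r = 0\<close> whenever \<open>g\<close> is in \<open>\<pp>\<close>, and \<open>f\<^sub>i\<^sup>N g\<close> is in \<open>P\<close>.  The same argument, for an index
  \<open>i\<close> with \<open>f\<^sub>i \<noteq> 0\<close>, shows that \<open>\<pp>\<close> is prime (\<open>horizontal_prime_primeideal\<close>).

  If all \<open>f\<^sub>i\<close> are in \<open>P\<close>, then so is \<open>f\<close>.  The contraction of \<open>P\<close> to \<open>R\<close> is then a prime over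
  \<open>(f\<^sub>1, \<dots>, f\<^sub>n, f)\<close>.  This ideal is nonzero, so in dimension one the primes over it are pairwise
  incomparable, and since \<open>R\<close> is noetherian there are finitely many of them
  (\<open>finite_primes_below\<close>).  They are the \<open>\<qq>\<^sub>j\<close>, and \<open>P\<close> lies in \<open>V(\<qq> B)\<close> for exactly one of them, its
  contraction.  The set \<open>V(\<qq> B)\<close> is irreducible because \<open>\<qq> B\<close>, the set of polynomials with all
  coefficients in \<open>\<qq>\<close>, is prime (\<open>primeideal_extended_ideal\<close>).
\<close>

section \<open>Connectedness of a finite union of irreducible closed sets\<close>

lemma irreducible_in_closed_UnD:
  assumes "irreducible_in Y S" "closedin Y C" "closedin Y D" "S \<subseteq> C \<union> D"
  shows "S \<subseteq> C \<or> S \<subseteq> D"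
  using assms unfolding irreducible_in_def by blast

lemma irreducible_in_closed_UnionD:
  assumes S: "irreducible_in Y S"
    and "finite \<W>" "\<And>W. W \<in> \<W> \<Longrightarrow> closedin Y W" "S \<subseteq> \<Union>\<W>"
  shows "\<exists>W\<in>\<W>. S \<subseteq> W"
  using assms(2-)
proof (induction \<W> rule: finite_induct)
  case empty
  then show ?case using S by (auto simp: irreducible_in_def)
next
  case (insert W \<W>)
  have "closedin Y (\<Union>\<W>)"
    using insert by (intro closedin_Union) auto
  then have "S \<subseteq> W \<or> S \<subseteq> \<Union>\<W>"
    using insert by (intro irreducible_in_closed_UnD[OF S]) auto
  then show ?case using insert by auto
qed

text \<open>Every component lies in \<open>H\<close> or in one member of \<open>\<W>\<close>, so by maximality a component other than \<open>H\<close> is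
itself a member of \<open>\<W>\<close>.  Some members of \<open>\<W>\<close> may be contained in \<open>H\<close>; such a member meets \<open>H\<close> trivially,
and any other member is a component because it is disjoint from the rest of \<open>\<W>\<close>.\<close>

lemma connected_iff_components_meet:
  assumes H: "irreducible_in Y H" "closedin Y H"
    and fin: "finite \<W>"
    and W: "\<And>W. W \<in> \<W> \<Longrightarrow> irreducible_in Y W \<and> closedin Y W"
    and disj: "\<And>W W'. W \<in> \<W> \<Longrightarrow> W' \<in> \<W> \<Longrightarrow> W \<noteq> W' \<Longrightarrow> W \<inter> W' = {}"
    and cover: "topspace Y = H \<union> \<Union>\<W>"
  shows "connected_nonempty Y \<longleftrightarrow> (\<forall>V \<in> irreducible_components Y - {H}. H \<inter> V \<noteq> {})"
proof
  assume conn: "connected_nonempty Y"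
  show "\<forall>V \<in> irreducible_components Y - {H}. H \<inter> V \<noteq> {}"
  proof (intro ballI notI)
    fix V assume V: "V \<in> irreducible_components Y - {H}" and HV: "H \<inter> V = {}"
    have irr: "irreducible_in Y V"
      and max: "\<And>T. irreducible_in Y T \<Longrightarrow> V \<subseteq> T \<Longrightarrow> T = V"
      using V by (auto simp: irreducible_components_def)
    have "V \<subseteq> \<Union>(insert H \<W>)"
      using irr cover by (auto simp: irreducible_in_def)
    then obtain Z where "Z \<in> insert H \<W>" "V \<subseteq> Z"
      using irreducible_in_closed_UnionD[OF irr, of "insert H \<W>"] fin H W by blast
    then have VW: "V \<in> \<W>"
      using max[of Z] H W V by auto
    define D where "D = H \<union> \<Union>(\<W> - {V})"
    have "closedin Y D"
      unfolding D_def using fin H W by (intro closedin_Un closedin_Union) auto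
    moreover have "closedin Y V" using W VW by blast
    moreover have "topspace Y \<subseteq> V \<union> D" using cover by (auto simp: D_def)
    moreover have "V \<inter> D = {}" using HV disj VW by (auto simp: D_def)
    moreover have "V \<noteq> {}" "D \<noteq> {}" using irr H by (auto simp: irreducible_in_def D_def)
    ultimately have "\<not> connected_space Y"
      unfolding connected_space_closedin by blast
    then show False using conn by (simp add: connected_nonempty_def)
  qed
next
  assume meet: "\<forall>V \<in> irreducible_components Y - {H}. H \<inter> V \<noteq> {}"
  have W_meets: "H \<inter> W \<noteq> {}" if WW: "W \<in> \<W>" for W
  proof (cases "W \<subseteq> H")
    case True
    then show ?thesis using W[OF WW] by (auto simp: irreducible_in_def)
  next
    case False
    have ne: "W \<noteq> {}" using W[OF WW] by (auto simp: irreducible_in_def)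
    have "T = W" if T: "irreducible_in Y T" "W \<subseteq> T" for T
    proof -
      have "T \<subseteq> \<Union>(insert H \<W>)"
        using T cover by (auto simp: irreducible_in_def)
      then obtain Z where Z: "Z \<in> insert H \<W>" "T \<subseteq> Z"
        using irreducible_in_closed_UnionD[OF T(1), of "insert H \<W>"] fin H W by blast
      then have "Z \<in> \<W>" using False T by auto
      then have "Z = W" using disj[OF _ WW, of Z] ne Z T by blast
      then show "T = W" using Z T by auto
    qed
    then have "W \<in> irreducible_components Y - {H}"
      using W[OF WW] False by (auto simp: irreducible_components_def)
    then show ?thesis using meet by blast
  qed
  have False if CD: "closedin Y C" "closedin Y D" "topspace Y \<subseteq> C \<union> D" "C \<inter> D = {}" "D \<noteq> {}"
    and HC: "H \<subseteq> C" for C D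
  proof -
    obtain x where "x \<in> D" using CD by blast
    then have "x \<in> H \<union> \<Union>\<W>" using cover closedin_subset[OF CD(2)] by blast
    then obtain W where WW: "W \<in> \<W>" "x \<in> W" using HC CD \<open>x \<in> D\<close> by blast
    have "W \<subseteq> C \<or> W \<subseteq> D"
      using W[OF WW(1)] CD by (intro irreducible_in_closed_UnD) (auto simp: irreducible_in_def)
    then show False using W_meets[OF WW(1)] WW \<open>x \<in> D\<close> HC CD by blast
  qed
  then have "connected_space Y"
    unfolding connected_space_closedin
    using irreducible_in_closed_UnD[OF H(1)] H
    by (smt (verit) Un_commute inf_commute irreducible_in_def subset_trans)
  then show "connected_nonempty Y"
    using H by (auto simp: connected_nonempty_def irreducible_in_def)
qed

section \<open>Prime ideals of noetherian rings\<close>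

text \<open>The proof is by noetherian induction, in the form of an ideal \<open>M\<close> that is maximal among the
counterexamples.  Such an \<open>M\<close> is proper and not prime, so it contains a product \<open>ab\<close> with \<open>a\<close> and \<open>b\<close>
outside \<open>M\<close>.  The larger ideals \<open>M + (a)\<close> and \<open>M + (b)\<close> have finite sets as required.  A prime over \<open>M\<close>
contains \<open>a\<close> or \<open>b\<close>, so the union of these two sets serves for \<open>M\<close>.\<close>

lemma finite_primes_below:
  assumes "cring R" "noetherian_ring R" "ideal I R"
  shows "\<exists>S. finite S \<and> (\<forall>P\<in>S. primeideal P R \<and> I \<subseteq> P) \<and>
    (\<forall>P. primeideal P R \<and> I \<subseteq> P \<longrightarrow> (\<exists>Q\<in>S. Q \<subseteq> P))"
proof (rule ccontr)
  interpret cring R by fact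
  interpret noetherian_ring R by fact
  define good where "good J S \<longleftrightarrow> finite S \<and> (\<forall>P\<in>S. primeideal P R \<and> J \<subseteq> P) \<and>
    (\<forall>P. primeideal P R \<and> J \<subseteq> P \<longrightarrow> (\<exists>Q\<in>S. Q \<subseteq> P))" for J S
  define \<B> where "\<B> = {J. ideal J R \<and> \<not> (\<exists>S. good J S)}"
  assume "\<nexists>S. finite S \<and> (\<forall>P\<in>S. primeideal P R \<and> I \<subseteq> P) \<and>
    (\<forall>P. primeideal P R \<and> I \<subseteq> P \<longrightarrow> (\<exists>Q\<in>S. Q \<subseteq> P))"
  then have "I \<in> \<B>" using assms(3) unfolding \<B>_def good_def by blast
  have "\<exists>M\<in>\<B>. \<forall>K\<in>\<B>. M \<subseteq> K \<longrightarrow> K = M"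
  proof (rule subset_Zorn)
    fix \<C> assume \<C>: "subset.chain \<B> \<C>"
    show "\<exists>U\<in>\<B>. \<forall>K\<in>\<C>. K \<subseteq> U"
    proof (cases "\<C> = {}")
      case True
      then show ?thesis using \<open>I \<in> \<B>\<close> by blast
    next
      case False
      have "subset.chain {J. ideal J R} \<C>"
        using \<C> by (auto simp: subset_chain_def \<B>_def)
      then have "\<Union>\<C> \<in> \<C>" by (rule ideal_chain_is_trivial[OF False])
      then show ?thesis using \<C> by (auto simp: subset_chain_def)
    qed
  qed
  then obtain M where M: "M \<in> \<B>" and max: "\<And>K. K \<in> \<B> \<Longrightarrow> M \<subseteq> K \<Longrightarrow> K = M" by blast
  have idM: "ideal M R" and bad: "\<And>S. \<not> good M S" using M by (auto simp: \<B>_def)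
  interpret M: ideal M R by (fact idM)
  have "\<not> primeideal M R"
    using bad[of "{M}"] by (auto simp: good_def)
  moreover have "carrier R \<noteq> M"
  proof
    assume "carrier R = M"
    then have "\<not> (primeideal P R \<and> M \<subseteq> P)" for P
      using primeideal.I_notcarr[of P R] additive_subgroup.a_subset[of P R]
      by (metis equalityI ideal.axioms(1) primeideal.axioms(1))
    then show False using bad[of "{}"] by (auto simp: good_def)
  qed
  ultimately obtain a b where ab: "a \<in> carrier R" "b \<in> carrier R" "a \<otimes>\<^bsub>R\<^esub> b \<in> M" "a \<notin> M" "b \<notin> M"
    using M.primeidealCD[OF assms(1)] by blast
  have ex: "\<exists>S. good (Idl\<^bsub>R\<^esub> (insert c M)) S" if c: "c \<in> carrier R" "c \<notin> M" for c
  proof -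
    have sub: "insert c M \<subseteq> carrier R" using c M.a_subset by blast
    then have "insert c M \<subseteq> Idl\<^bsub>R\<^esub> (insert c M)" "ideal (Idl\<^bsub>R\<^esub> (insert c M)) R"
      using genideal_self[OF sub] genideal_ideal[OF sub] by simp_all
    then show ?thesis using max[of "Idl\<^bsub>R\<^esub> (insert c M)"] c by (auto simp: \<B>_def)
  qed
  have sub: "Idl\<^bsub>R\<^esub> (insert c M) \<subseteq> P \<longleftrightarrow> c \<in> P \<and> M \<subseteq> P"
    if "c \<in> carrier R" "primeideal P R" for c P
    using subset_Idl_subset genideal_minimal[of P "insert c M"] genideal_self[of "insert c M"]
      that M.a_subset primeideal.axioms(1)[OF that(2)] by blast
  obtain Sa Sb where S: "good (Idl\<^bsub>R\<^esub> (insert a M)) Sa" "good (Idl\<^bsub>R\<^esub> (insert b M)) Sb"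
    using ex ab by blast
  have "good M (Sa \<union> Sb)"
    unfolding good_def
  proof (intro conjI ballI allI impI)
    show "finite (Sa \<union> Sb)" using S by (simp add: good_def)
  next
    fix P assume "P \<in> Sa \<union> Sb"
    then have P: "primeideal P R \<and> (Idl\<^bsub>R\<^esub> (insert a M) \<subseteq> P \<or> Idl\<^bsub>R\<^esub> (insert b M) \<subseteq> P)"
      using S by (auto simp: good_def)
    then show "primeideal P R" by blast
    show "M \<subseteq> P" using P sub[OF ab(1)] sub[OF ab(2)] by blast
  next
    fix P assume P: "primeideal P R \<and> M \<subseteq> P"
    then have "a \<in> P \<or> b \<in> P"
      using primeideal.I_prime[of P R a b] ab by blast
    then have "Idl\<^bsub>R\<^esub> (insert a M) \<subseteq> P \<or> Idl\<^bsub>R\<^esub> (insert b M) \<subseteq> P"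
      using P sub[OF ab(1)] sub[OF ab(2)] by blast
    then have "(\<exists>Q\<in>Sa. Q \<subseteq> P) \<or> (\<exists>Q\<in>Sb. Q \<subseteq> P)"
      using S P by (auto simp: good_def)
    then show "\<exists>Q\<in>Sa \<union> Sb. Q \<subseteq> P" by blast
  qed
  then show False using bad by blast
qed

text \<open>Otherwise \<open>0 \<subset> P \<subset> Q\<close> would be a chain of primes of length two.\<close>

lemma krull_dim_1_prime_antichain:
  assumes "krull_dim R = 1" "domain R"
    and "primeideal P R" "primeideal Q R" "P \<noteq> {\<zero>\<^bsub>R\<^esub>}" "P \<subseteq> Q"
  shows "P = Q"
proof (rule ccontr)
  assume "P \<noteq> Q"
  interpret domain R by fact
  have "\<zero>\<^bsub>R\<^esub> \<in> P"
    using assms(3) by (simp add: additive_subgroup.zero_closed ideal.axioms(1) primeideal.axioms(1))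
  define C where "C i = (if i = 0 then {\<zero>\<^bsub>R\<^esub>} else if i = 1 then P else Q)" for i :: nat
  have "(\<forall>i\<le>2. primeideal (C i) R) \<and> (\<forall>i<2. C i \<subset> C (Suc i))"
    using assms \<open>P \<noteq> Q\<close> \<open>\<zero>\<^bsub>R\<^esub> \<in> P\<close> zeroprimeideal by (auto simp: C_def less_2_cases_iff)
  then have "enat 2 \<le> krull_dim R"
    unfolding krull_dim_def by (intro Sup_upper) blast
  then show False using assms(1) by (simp add: one_enat_def)
qed

lemma ring_of_type_simps [simp]:
  "carrier ring_of_type_algebra = UNIV"
  "x \<otimes>\<^bsub>ring_of_type_algebra\<^esub> y = x * y"
  "x \<oplus>\<^bsub>ring_of_type_algebra\<^esub> y = x + y"
  "\<zero>\<^bsub>ring_of_type_algebra\<^esub> = 0"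
  "\<one>\<^bsub>ring_of_type_algebra\<^esub> = 1"
  by (simp_all add: ring_of_type_algebra_def)

text \<open>The two characterizations below translate ideals of the ring structure on a type into closure
conditions on a set, stated with the operations of the type class.\<close>

lemma ideal_ring_of_type_iff:
  fixes I :: "'a::comm_ring_1 set"
  shows "ideal I ring_of_type_algebra \<longleftrightarrow>
    0 \<in> I \<and> (\<forall>x\<in>I. \<forall>y\<in>I. x + y \<in> I) \<and> (\<forall>x\<in>I. \<forall>r. r * x \<in> I)"
proof
  assume "ideal I ring_of_type_algebra"
  then interpret ideal I "ring_of_type_algebra :: 'a ring" .
  show "0 \<in> I \<and> (\<forall>x\<in>I. \<forall>y\<in>I. x + y \<in> I) \<and> (\<forall>x\<in>I. \<forall>r. r * x \<in> I)"
    using additive_subgroup.zero_closed[OF is_additive_subgroup]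
      additive_subgroup.a_closed[OF is_additive_subgroup] I_l_closed
    by auto
next
  assume I: "0 \<in> I \<and> (\<forall>x\<in>I. \<forall>y\<in>I. x + y \<in> I) \<and> (\<forall>x\<in>I. \<forall>r. r * x \<in> I)"
  interpret cring "ring_of_type_algebra :: 'a ring" by (rule cring_from_type_algebra)
  have "\<ominus>\<^bsub>ring_of_type_algebra\<^esub> x = - x" for x :: 'a
    by (rule minus_equality) auto
  moreover have "- x \<in> I" if "x \<in> I" for x
    using I that by (metis mult_minus1)
  ultimately have "subgroup I (add_monoid (ring_of_type_algebra :: 'a ring))"
    using I by (intro add.subgroupI) auto
  then show "ideal I ring_of_type_algebra"
    using I by (intro idealI local.ring_axioms)
      (auto simp: mult.commute)
qed

lemma primeideal_ring_of_type_iff: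
  fixes P :: "'a::comm_ring_1 set"
  shows "primeideal P ring_of_type_algebra \<longleftrightarrow>
    0 \<in> P \<and> (\<forall>x\<in>P. \<forall>y\<in>P. x + y \<in> P) \<and> (\<forall>x\<in>P. \<forall>r. r * x \<in> P) \<and> 1 \<notin> P \<and>
    (\<forall>x y. x * y \<in> P \<longrightarrow> x \<in> P \<or> y \<in> P)" (is "?l \<longleftrightarrow> ?r")
proof
  assume ?l
  then interpret primeideal P "ring_of_type_algebra :: 'a ring" .
  have "1 \<notin> P" using I_notcarr one_imp_carrier by auto
  then show ?r
    using is_ideal I_prime unfolding ideal_ring_of_type_iff
    by auto
next
  assume ?r
  then show ?l
    by (intro primeidealI cring_from_type_algebra)
      (auto simp: ideal_ring_of_type_iff)
qed

lemma domain_ring_of_type: "domain (ring_of_type_algebra :: 'a::idom ring)"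
  by (intro domain.intro cring_from_type_algebra domain_axioms.intro)
    auto

lemma genideal_singleton_ring_of_type:
  "genideal ring_of_type_algebra {a :: 'a::comm_ring_1} = {h * a | h. True}"
  using cring.cgenideal_eq_genideal[OF cring_from_type_algebra, of a]
  by (auto simp: cgenideal_def)

section \<open>Coefficients of products and extended ideals\<close>

text \<open>A finite index type carries no order in general, and hence neither do its exponent vectors.
Numbering the variables embeds the exponent vectors into those indexed by \<^typ>\<open>nat\<close>, which are
totally ordered in a way that is compatible with addition.\<close>

lemma exists_monomial_embedding:
  "\<exists>\<mu> :: ('n::finite \<Rightarrow>\<^sub>0 nat) \<Rightarrow> (nat \<Rightarrow>\<^sub>0 nat). inj \<mu> \<and> (\<forall>a b. \<mu> (a + b) = \<mu> a + \<mu> b)"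
proof (intro exI conjI allI)
  let ?\<mu> = "\<lambda>m :: 'n \<Rightarrow>\<^sub>0 nat. \<Sum>k\<in>UNIV. Poly_Mapping.single (to_nat k) (Poly_Mapping.lookup m k)"
  have "Poly_Mapping.lookup (?\<mu> m) (to_nat k) = Poly_Mapping.lookup m k" for m k
    by (simp add: Poly_Mapping.lookup_sum lookup_single when_def)
  then show "inj ?\<mu>"
    by (metis (no_types, lifting) injI poly_mapping_eqI)
  show "?\<mu> (a + b) = ?\<mu> a + ?\<mu> b" for a b
    by (simp add: lookup_add single_add sum.distrib)
qed

lemma sum_mem_additive:
  assumes "0 \<in> Q" "\<And>x y. x \<in> Q \<Longrightarrow> y \<in> Q \<Longrightarrow> x + y \<in> Q" "\<And>x. x \<in> A \<Longrightarrow> f x \<in> Q"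
  shows "sum f A \<in> Q"
  using assms by (induction A rule: infinite_finite_induct) auto

text \<open>The common form of two leading-term arguments: if modulo \<open>Q\<close> only the pair \<open>(m, m')\<close> contributes to
the coefficient of the product at \<open>m + m'\<close>, then modulo \<open>Q\<close> that coefficient is the product of two
coefficients.\<close>

lemma lookup_mult_isolated:
  fixes g h :: "'m::comm_monoid_add \<Rightarrow>\<^sub>0 'a::comm_ring_1"
  assumes Q: "ideal Q ring_of_type_algebra"
    and iso: "\<And>a b. a + b = m + m' \<Longrightarrow> (a, b) \<noteq> (m, m') \<Longrightarrow>
      Poly_Mapping.lookup g a \<in> Q \<or> Poly_Mapping.lookup h b \<in> Q"
  shows "\<exists>r\<in>Q. Poly_Mapping.lookup (g * h) (m + m') =
    Poly_Mapping.lookup g m * Poly_Mapping.lookup h m' + r"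
proof -
  let ?g = "Poly_Mapping.lookup g" and ?h = "Poly_Mapping.lookup h"
  let ?K = "(Poly_Mapping.keys g \<union> {m}) \<times> (Poly_Mapping.keys h \<union> {m'})"
  let ?t = "\<lambda>(a, b). ?g a * ?h b when m + m' = a + b"
  have Q': "0 \<in> Q" "\<And>x y. x \<in> Q \<Longrightarrow> y \<in> Q \<Longrightarrow> x + y \<in> Q" "\<And>r x. x \<in> Q \<Longrightarrow> r * x \<in> Q"
    using Q by (auto simp: ideal_ring_of_type_iff)
  have "Poly_Mapping.lookup (g * h) (m + m') = (\<Sum>(a, b). ?g a * ?h b when m + m' = a + b)"
    by (simp add: times_poly_mapping.rep_eq prod_fun_unfold_prod)
  also have "\<dots> = sum ?t ?K"
    by (rule Sum_any.expand_superset) (auto simp: when_def in_keys_iff split: if_splits)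
  also have "\<dots> = ?t (m, m') + sum ?t (?K - {(m, m')})"
    by (rule sum.remove) auto
  finally have "Poly_Mapping.lookup (g * h) (m + m') = ?g m * ?h m' + sum ?t (?K - {(m, m')})"
    by simp
  moreover have "?t x \<in> Q" if "x \<noteq> (m, m')" for x
  proof (cases x)
    case (Pair a b)
    then show ?thesis
      using that iso[of a b] Q'(1) Q'(3)[of "?g a" "?h b"] Q'(3)[of "?h b" "?g a"]
      by (auto simp: when_def mult.commute)
  qed
  then have "sum ?t (?K - {(m, m')}) \<in> Q"
    by (intro sum_mem_additive) (use Q' in auto)
  ultimately show ?thesis by blast
qed

text \<open>For an ideal \<open>Q\<close> of \<open>R\<close> this is the ideal of \<open>R[T\<^sub>1, \<dots>, T\<^sub>n]\<close> that \<open>Q\<close> generates.\<close>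

definition extended_ideal :: "'a::comm_ring_1 set \<Rightarrow> ('n, 'a) mpoly set" where
  "extended_ideal Q = {g. \<forall>m. Poly_Mapping.lookup g m \<in> Q}"

lemma finite_lookup_notin:
  assumes "0 \<in> Q" shows "finite {m. Poly_Mapping.lookup g m \<notin> Q}"
  by (rule finite_subset[of _ "Poly_Mapping.keys g"]) (use assms in \<open>auto simp: in_keys_iff\<close>)

lemma lookup_const_mult:
  "Poly_Mapping.lookup (mpoly_const a * g) m = a * Poly_Mapping.lookup g m"
  unfolding mpoly_const_def mult_map_scale_conv_mult[symmetric]
  by (simp add: Poly_Mapping.map.rep_eq when_def)

text \<open>Gauss's argument: if \<open>g\<close> and \<open>h\<close> both have a coefficient outside \<open>Q\<close>, take in each the largest
monomial with this property.  The product of these two monomials has in \<open>g * h\<close> a coefficient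
outside \<open>Q\<close>.\<close>

lemma primeideal_extended_ideal:
  assumes Q: "primeideal Q ring_of_type_algebra"
  shows "primeideal (extended_ideal Q :: ('n::finite, 'a::comm_ring_1) mpoly set) ring_of_type_algebra"
proof -
  have Q': "0 \<in> Q" "1 \<notin> Q" "\<And>x y. x \<in> Q \<Longrightarrow> y \<in> Q \<Longrightarrow> x + y \<in> Q" "\<And>r x. x \<in> Q \<Longrightarrow> r * x \<in> Q"
    "\<And>x y. x * y \<in> Q \<Longrightarrow> x \<in> Q \<or> y \<in> Q"
    and idQ: "ideal Q ring_of_type_algebra"
    using Q by (auto simp: primeideal_ring_of_type_iff ideal_ring_of_type_iff)
  obtain \<mu> :: "('n \<Rightarrow>\<^sub>0 nat) \<Rightarrow> (nat \<Rightarrow>\<^sub>0 nat)" where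
    \<mu>: "inj \<mu>" "\<And>a b. \<mu> (a + b) = \<mu> a + \<mu> b"
    using exists_monomial_embedding by blast
  have top: "\<exists>m. Poly_Mapping.lookup g m \<notin> Q \<and>
      (\<forall>a. Poly_Mapping.lookup g a \<notin> Q \<longrightarrow> \<mu> a \<le> \<mu> m)"
    if "g \<notin> extended_ideal Q" for g :: "('n, 'a) mpoly"
  proof -
    let ?B = "{m. Poly_Mapping.lookup g m \<notin> Q}"
    have "finite (\<mu> ` ?B)" "\<mu> ` ?B \<noteq> {}"
      using finite_lookup_notin[OF Q'(1)] that by (auto simp: extended_ideal_def)
    then have "Max (\<mu> ` ?B) \<in> \<mu> ` ?B" "\<forall>x\<in>\<mu> ` ?B. x \<le> Max (\<mu> ` ?B)"
      by auto
    then show ?thesis by force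
  qed
  have prime: "g \<in> extended_ideal Q \<or> h \<in> extended_ideal Q"
    if gh: "g * h \<in> extended_ideal Q" for g h :: "('n, 'a) mpoly"
  proof (rule ccontr)
    assume "\<not> (g \<in> extended_ideal Q \<or> h \<in> extended_ideal Q)"
    then obtain m m' where
      m: "Poly_Mapping.lookup g m \<notin> Q" "\<And>a. Poly_Mapping.lookup g a \<notin> Q \<Longrightarrow> \<mu> a \<le> \<mu> m" and
      m': "Poly_Mapping.lookup h m' \<notin> Q" "\<And>a. Poly_Mapping.lookup h a \<notin> Q \<Longrightarrow> \<mu> a \<le> \<mu> m'"
      using top[of g] top[of h] by blast
    have "Poly_Mapping.lookup g a \<in> Q \<or> Poly_Mapping.lookup h b \<in> Q"
      if ab: "a + b = m + m'" "(a, b) \<noteq> (m, m')" for a b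
    proof (rule ccontr)
      assume "\<not> (Poly_Mapping.lookup g a \<in> Q \<or> Poly_Mapping.lookup h b \<in> Q)"
      then have le: "\<mu> a \<le> \<mu> m" "\<mu> b \<le> \<mu> m'" using m m' by auto
      \<comment> \<open>Both summands are at most as large as those of \<open>m + m'\<close> and the sums agree, so they are equal.\<close>
    have eq: "\<mu> a + \<mu> b = \<mu> m + \<mu> m'" using \<mu>(2) ab(1) by metis
      have "\<mu> a = \<mu> m"
        using le eq add_less_le_mono[of "\<mu> a" "\<mu> m" "\<mu> b" "\<mu> m'"] by fastforce
      then show False
        using eq \<mu>(1) ab(2) by (auto simp: inj_eq)
    qed
    from lookup_mult_isolated[OF idQ this]
    obtain r where r: "r \<in> Q" "Poly_Mapping.lookup (g * h) (m + m') =
        Poly_Mapping.lookup g m * Poly_Mapping.lookup h m' + r" by blast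
    have "Poly_Mapping.lookup (g * h) (m + m') \<in> Q" using gh by (simp add: extended_ideal_def)
    then have "Poly_Mapping.lookup (g * h) (m + m') + (- 1) * r \<in> Q"
      using Q'(3,4) r(1) by blast
    then have "Poly_Mapping.lookup g m * Poly_Mapping.lookup h m' \<in> Q"
      unfolding r(2) by simp
    then show False using Q'(5) m m' by blast
  qed
  have mult: "r * g \<in> extended_ideal Q" if g: "g \<in> extended_ideal Q" for r g :: "('n, 'a) mpoly"
    unfolding extended_ideal_def
  proof (intro CollectI allI)
    fix k
    have "Poly_Mapping.lookup (r * g) k =
        (\<Sum>l. Poly_Mapping.lookup r l * (\<Sum>q. Poly_Mapping.lookup g q when k = l + q))"
      by (simp add: lookup_mult)
    also have "\<dots> \<in> Q"
      unfolding Sum_any.expand_set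
      by (intro sum_mem_additive Q') (use g Q' in \<open>auto simp: extended_ideal_def when_def\<close>)
    finally show "Poly_Mapping.lookup (r * g) k \<in> Q" .
  qed
  have "(1 :: ('n, 'a) mpoly) \<notin> extended_ideal Q"
    using Q'(2) by (auto simp: extended_ideal_def lookup_one intro!: exI[of _ 0])
  then show ?thesis
    using prime mult Q' unfolding primeideal_ring_of_type_iff
    by (auto simp: extended_ideal_def lookup_add)
qed

text \<open>The case \<open>Q = 0\<close> of the previous lemma: polynomials over a domain have no zero divisors.\<close>

lemma mpoly_mult_eq_0D:
  fixes g h :: "('n::finite, 'a::idom) mpoly"
  assumes "g * h = 0" shows "g = 0 \<or> h = 0"
proof -
  have "primeideal {0 :: 'a} ring_of_type_algebra"
    using domain.zeroprimeideal[OF domain_ring_of_type] by simp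
  from primeideal_extended_ideal[OF this] assms
  have "g \<in> extended_ideal {0} \<or> h \<in> extended_ideal {0}"
    unfolding primeideal_ring_of_type_iff by (metis)
  then show ?thesis
    by (auto simp: extended_ideal_def intro!: poly_mapping_eqI)
qed

lemma mpoly_const_add: "mpoly_const (a + b) = mpoly_const a + mpoly_const b"
  by (simp add: mpoly_const_def single_add)

lemma mpoly_const_mult: "mpoly_const (a * b) = mpoly_const a * mpoly_const b"
  by (simp add: mpoly_const_def mult_single)

lemma mpoly_const_0 [simp]: "mpoly_const 0 = 0"
  by (simp add: mpoly_const_def)

lemma mpoly_const_1 [simp]: "mpoly_const 1 = 1"
  by (simp add: mpoly_const_def)

lemma mpoly_const_power: "mpoly_const (a ^ N) = mpoly_const a ^ N"
  by (induction N) (simp_all add: mpoly_const_mult)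

lemma mpoly_const_eq_0_iff [simp]: "mpoly_const a = 0 \<longleftrightarrow> a = 0"
  unfolding mpoly_const_def by (metis lookup_single_eq lookup_zero single_zero)

lemma mpoly_induct [case_names const var add mult]:
  fixes g :: "('n::finite, 'a::comm_ring_1) mpoly"
  assumes const: "\<And>a. P (mpoly_const a)" and var: "\<And>i. P (mpoly_var i)"
    and add: "\<And>g h. P g \<Longrightarrow> P h \<Longrightarrow> P (g + h)" and mult: "\<And>g h. P g \<Longrightarrow> P h \<Longrightarrow> P (g * h)"
  shows "P g"
proof (induction g rule: Poly_Mapping.update_induct)
  case const
  then show ?case using assms(1)[of 0] by simp
next
  case (update f m a)
  have "P (Poly_Mapping.single m 1)"
  proof (induction m rule: Poly_Mapping.update_induct)
    case const
    then show ?case using assms(1)[of 1] by simp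
  next
    case (update m k e)
    have "P (Poly_Mapping.single (Poly_Mapping.single k e) 1)"
    proof (induction e)
      case 0
      then show ?case using assms(1)[of 1] by simp
    next
      case (Suc e)
      have "Poly_Mapping.single (Poly_Mapping.single k (Suc e)) (1 :: 'a) =
          mpoly_var k * Poly_Mapping.single (Poly_Mapping.single k e) 1"
        by (simp add: mpoly_var_def mult_single single_add[symmetric])
      then show ?case using mult var Suc by metis
    qed
    moreover have "Poly_Mapping.update k e m = Poly_Mapping.single k e + m"
      using update(1) by (intro poly_mapping_eqI)
        (auto simp: lookup_update lookup_add lookup_single in_keys_iff)
    then have "Poly_Mapping.single (Poly_Mapping.update k e m) (1 :: 'a) =
        Poly_Mapping.single (Poly_Mapping.single k e) 1 * Poly_Mapping.single m 1"
      by (simp add: mult_single)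
    ultimately show ?case using update(3) mult by metis
  qed
  moreover have "Poly_Mapping.update m a f = mpoly_const a * Poly_Mapping.single m 1 + f"
    using update(1) by (intro poly_mapping_eqI)
      (auto simp: lookup_update lookup_add lookup_single lookup_const_mult in_keys_iff when_def)
  ultimately show ?case using update(3) mult add const by metis
qed

section \<open>Pseudo-division by the forcing polynomial\<close>

text \<open>The polynomials in the variables other than \<open>T\<^sub>i\<close>; they form a subring.\<close>

definition var_free :: "'n \<Rightarrow> ('n, 'a::comm_ring_1) mpoly set" where
  "var_free i = {g. \<forall>m\<in>Poly_Mapping.keys g. Poly_Mapping.lookup m i = 0}"

lemma var_free_add: "g \<in> var_free i \<Longrightarrow> h \<in> var_free i \<Longrightarrow> g + h \<in> var_free i"
  using Poly_Mapping.keys_add[of g h] by (auto simp: var_free_def)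

lemma var_free_mult: "g \<in> var_free i \<Longrightarrow> h \<in> var_free i \<Longrightarrow> g * h \<in> var_free i"
  using keys_mult[of g h] by (fastforce simp: var_free_def lookup_add)

lemma var_free_const: "mpoly_const a \<in> var_free i"
  by (auto simp: var_free_def mpoly_const_def split: if_splits)

lemma var_free_var: "j \<noteq> i \<Longrightarrow> mpoly_var j \<in> var_free i"
  by (auto simp: var_free_def mpoly_var_def lookup_single split: if_splits)

lemma var_free_uminus: "g \<in> var_free i \<Longrightarrow> - g \<in> var_free i"
  by (auto simp: var_free_def in_keys_iff)

lemma forcing_poly_split:
  "forcing_poly fs f - mpoly_const (fs i) * mpoly_var i \<in> var_free i"
proof -
  have "(\<Sum>j\<in>UNIV - {i}. mpoly_const (fs j) * mpoly_var j) \<in> var_free i"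
    using var_free_const[of 0 i]
    by (intro sum_mem_additive var_free_add var_free_mult var_free_const var_free_var) auto
  then show ?thesis
    unfolding forcing_poly_def
    by (subst sum.remove[of UNIV i]) (auto intro!: var_free_add var_free_const simp: algebra_simps)
qed

text \<open>Among the monomials of \<open>k\<close> take one, \<open>m\<close>, with the largest exponent of \<open>T\<^sub>i\<close>.  In \<open>F\<close> only the monomial
\<open>T\<^sub>i\<close> involves \<open>T\<^sub>i\<close>, so \<open>m T\<^sub>i\<close> occurs in \<open>k * F\<close> with the coefficient of \<open>m\<close> times \<open>f\<^sub>i\<close>.\<close>

lemma multiple_not_var_free:
  fixes k :: "('n::finite, 'a::idom) mpoly"
  assumes "fs i \<noteq> 0" "k * forcing_poly fs f \<in> var_free i"
  shows "k = 0"
proof (rule ccontr)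
  assume "k \<noteq> 0"
  let ?F = "forcing_poly fs f" and ?e = "Poly_Mapping.single i 1 :: 'n \<Rightarrow>\<^sub>0 nat"
  define E where "E = ?F - mpoly_const (fs i) * mpoly_var i"
  have F: "?F = mpoly_const (fs i) * mpoly_var i + E" by (simp add: E_def)
  have "E \<in> var_free i" using forcing_poly_split[of fs f i] by (simp add: E_def)
  then have E: "Poly_Mapping.lookup E b = 0" if "Poly_Mapping.lookup b i \<noteq> 0" for b
    using that by (metis (mono_tags, lifting) in_keys_iff mem_Collect_eq var_free_def)
  have Fe: "Poly_Mapping.lookup ?F ?e = fs i"
    by (simp add: F lookup_add E lookup_const_mult mpoly_var_def)
  have Fb: "Poly_Mapping.lookup b i = 0" if "b \<noteq> ?e" "Poly_Mapping.lookup ?F b \<noteq> 0" for b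
    using that E[of b] by (auto simp: F lookup_add lookup_const_mult mpoly_var_def lookup_single when_def)
  let ?D = "(\<lambda>m. Poly_Mapping.lookup m i) ` Poly_Mapping.keys k"
  have "finite ?D" "?D \<noteq> {}" using \<open>k \<noteq> 0\<close> by auto
  then have "Max ?D \<in> ?D" "\<forall>d\<in>?D. d \<le> Max ?D" by auto
  then obtain m where m: "m \<in> Poly_Mapping.keys k"
    and max: "\<And>a. a \<in> Poly_Mapping.keys k \<Longrightarrow> Poly_Mapping.lookup a i \<le> Poly_Mapping.lookup m i"
    by force
  have "Poly_Mapping.lookup k a \<in> {0} \<or> Poly_Mapping.lookup ?F b \<in> {0}"
    if ab: "a + b = m + ?e" "(a, b) \<noteq> (m, ?e)" for a b
  proof (rule ccontr)
    assume *: "\<not> (Poly_Mapping.lookup k a \<in> {0} \<or> Poly_Mapping.lookup ?F b \<in> {0})"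
    then have "b \<noteq> ?e" using ab by auto
    then have "Poly_Mapping.lookup a i = Suc (Poly_Mapping.lookup m i)"
      using Fb[of b] * arg_cong[OF ab(1), of "\<lambda>m. Poly_Mapping.lookup m i"]
      by (simp add: lookup_add)
    then show False using max[of a] * by (auto simp: in_keys_iff)
  qed
  then have "Poly_Mapping.lookup (k * ?F) (m + ?e) = Poly_Mapping.lookup k m * fs i"
    using lookup_mult_isolated[of "{0}" m ?e k ?F] unfolding Fe
    by (simp add: ideal_ring_of_type_iff)
  then have "m + ?e \<in> Poly_Mapping.keys (k * ?F)"
    using m assms(1) by (simp add: in_keys_iff)
  then show False using assms(2) by (force simp: var_free_def lookup_add)
qed

text \<open>The polynomials \<open>g\<close> with this property contain the constants and the variables and are closed under
sums and products.  The only variable that needs a division is \<open>T\<^sub>i\<close>, where \<open>f\<^sub>i T\<^sub>i - F\<close> is free of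
\<open>T\<^sub>i\<close>.\<close>

lemma forcing_pseudo_division:
  fixes fs :: "'n::finite \<Rightarrow> 'a::comm_ring_1"
  shows "\<exists>N h. mpoly_const (fs i) ^ N * g - h * forcing_poly fs f \<in> var_free i"
proof (induction g rule: mpoly_induct)
  case (const a)
  have "mpoly_const (fs i) ^ 0 * mpoly_const a - 0 * forcing_poly fs f \<in> var_free i"
    by (simp add: var_free_const)
  then show ?case by blast
next
  case (var j)
  show ?case
  proof (cases "j = i")
    case True
    have "mpoly_const (fs i) ^ 1 * mpoly_var i - 1 * forcing_poly fs f \<in> var_free i"
      using var_free_uminus[OF forcing_poly_split[of fs f i]] by (simp add: algebra_simps)
    then show ?thesis using True by blast
  next
    case False
    have "mpoly_const (fs i) ^ 0 * mpoly_var j - 0 * forcing_poly fs f \<in> var_free i"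
      using False by (simp add: var_free_var)
    then show ?thesis by blast
  qed
next
  case (add g g')
  let ?c = "mpoly_const (fs i)" and ?F = "forcing_poly fs f"
  obtain N h N' h' where *: "?c ^ N * g - h * ?F \<in> var_free i" "?c ^ N' * g' - h' * ?F \<in> var_free i"
    using add by blast
  have "?c ^ N' * (?c ^ N * g - h * ?F) + ?c ^ N * (?c ^ N' * g' - h' * ?F) \<in> var_free i"
    using * by (intro var_free_add var_free_mult)
      (auto simp: mpoly_const_power[symmetric] var_free_const)
  also have "?c ^ N' * (?c ^ N * g - h * ?F) + ?c ^ N * (?c ^ N' * g' - h' * ?F) =
      ?c ^ (N + N') * (g + g') - (?c ^ N' * h + ?c ^ N * h') * ?F"
    by (simp add: algebra_simps power_add)
  finally show ?case by blast
next
  case (mult g g')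
  let ?c = "mpoly_const (fs i)" and ?F = "forcing_poly fs f"
  obtain N h N' h' where *: "?c ^ N * g - h * ?F \<in> var_free i" "?c ^ N' * g' - h' * ?F \<in> var_free i"
    using mult by blast
  have "(?c ^ N * g - h * ?F) * (?c ^ N' * g' - h' * ?F) \<in> var_free i"
    using * by (rule var_free_mult)
  also have "(?c ^ N * g - h * ?F) * (?c ^ N' * g' - h' * ?F) =
      ?c ^ (N + N') * (g * g') - (?c ^ N * g * h' + ?c ^ N' * g' * h - h * h' * ?F) * ?F"
    by (simp add: algebra_simps power_add)
  finally show ?case by blast
qed

section \<open>The horizontal prime\<close>

lemma lookup_mpoly_to_fract:
  "Poly_Mapping.lookup (mpoly_to_fract g) m = Fraction_Field.Fract (Poly_Mapping.lookup g m) 1"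
  by (simp add: mpoly_to_fract_def Poly_Mapping.map.rep_eq when_def fract_collapse)

lemma mpoly_to_fract_const: "mpoly_to_fract (mpoly_const a) = mpoly_const (Fraction_Field.Fract a 1)"
  by (simp add: mpoly_to_fract_def mpoly_const_def fract_collapse)

lemma mpoly_to_fract_var: "mpoly_to_fract (mpoly_var i) = mpoly_var i"
  by (simp add: mpoly_to_fract_def mpoly_var_def fract_collapse)

lemma mpoly_to_fract_add: "mpoly_to_fract (g + h) = mpoly_to_fract g + mpoly_to_fract h"
  by (intro poly_mapping_eqI) (simp add: lookup_mpoly_to_fract lookup_add)

lemma inj_mpoly_to_fract: "inj mpoly_to_fract"
  by (intro injI poly_mapping_eqI)
    (metis lookup_mpoly_to_fract eq_fract(1) mult.right_neutral zero_neq_one)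

lemma mpoly_to_fract_0: "mpoly_to_fract 0 = 0"
  using mpoly_to_fract_const[of 0] by (simp add: fract_collapse)

lemma mpoly_to_fract_single_mult:
  "mpoly_to_fract (Poly_Mapping.single m a * h) = mpoly_to_fract (Poly_Mapping.single m a) * mpoly_to_fract h"
proof (induction h rule: Poly_Mapping.update_induct)
  case const
  show ?case by (simp add: mpoly_to_fract_0)
next
  case (update h k b)
  have "Poly_Mapping.update k b h = Poly_Mapping.single k b + h"
    using update(1) by (intro poly_mapping_eqI)
      (auto simp: lookup_update lookup_add lookup_single in_keys_iff)
  moreover have "mpoly_to_fract (Poly_Mapping.single m a * Poly_Mapping.single k b) =
      mpoly_to_fract (Poly_Mapping.single m a) * mpoly_to_fract (Poly_Mapping.single k b)"
    by (simp add: mpoly_to_fract_def mult_single fract_collapse)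
  ultimately show ?case
    using update(3) by (simp add: mpoly_to_fract_add distrib_left)
qed

lemma mpoly_to_fract_mult: "mpoly_to_fract (g * h) = mpoly_to_fract g * mpoly_to_fract h"
proof (induction g rule: Poly_Mapping.update_induct)
  case const
  show ?case by (simp add: mpoly_to_fract_0)
next
  case (update g k b)
  have "Poly_Mapping.update k b g = Poly_Mapping.single k b + g"
    using update(1) by (intro poly_mapping_eqI)
      (auto simp: lookup_update lookup_add lookup_single in_keys_iff)
  then show ?case
    using update(3) by (simp add: mpoly_to_fract_add distrib_right mpoly_to_fract_single_mult)
qed

lemma clear_denominators:
  fixes h :: "('n::finite, 'a::idom fract) mpoly"
  shows "\<exists>a g. a \<noteq> 0 \<and> mpoly_const (Fraction_Field.Fract a 1) * h = mpoly_to_fract g"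
proof (induction h rule: mpoly_induct)
  case (const x)
  obtain a b where x: "x = Fraction_Field.Fract a b" "b \<noteq> 0" by (cases x) auto
  have "Fraction_Field.Fract b 1 * x = Fraction_Field.Fract a 1"
    using x by (simp add: eq_fract)
  then have "mpoly_const (Fraction_Field.Fract b 1) * mpoly_const x = mpoly_to_fract (mpoly_const a)"
    by (simp only: mpoly_to_fract_const mpoly_const_mult[symmetric])
  then show ?case using x by blast
next
  case (var i)
  have "mpoly_const (Fraction_Field.Fract 1 1) * mpoly_var i =
      mpoly_to_fract (mpoly_var i :: ('n, 'a) mpoly)"
    by (simp add: mpoly_to_fract_var fract_collapse)
  then show ?case using zero_neq_one by metis
next
  case (add h h')
  then obtain a g a' g' where *: "a \<noteq> 0" "a' \<noteq> 0"
    "mpoly_const (Fraction_Field.Fract a 1) * h = mpoly_to_fract g"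
    "mpoly_const (Fraction_Field.Fract a' 1) * h' = mpoly_to_fract g'" by blast
  have "mpoly_const (Fraction_Field.Fract (a * a') 1) * (h + h') =
      mpoly_to_fract (mpoly_const a') * (mpoly_const (Fraction_Field.Fract a 1) * h) +
      mpoly_to_fract (mpoly_const a) * (mpoly_const (Fraction_Field.Fract a' 1) * h')"
    by (simp add: mpoly_to_fract_const mpoly_const_mult[symmetric] algebra_simps)
  also have "\<dots> = mpoly_to_fract (mpoly_const a' * g + mpoly_const a * g')"
    by (simp only: * mpoly_to_fract_mult mpoly_to_fract_add)
  finally show ?case using * by (metis mult_eq_0_iff)
next
  case (mult h h')
  then obtain a g a' g' where *: "a \<noteq> 0" "a' \<noteq> 0"
    "mpoly_const (Fraction_Field.Fract a 1) * h = mpoly_to_fract g"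
    "mpoly_const (Fraction_Field.Fract a' 1) * h' = mpoly_to_fract g'" by blast
  have "mpoly_const (Fraction_Field.Fract (a * a') 1) =
      (mpoly_const (Fraction_Field.Fract a 1) * mpoly_const (Fraction_Field.Fract a' 1) :: ('n, _) mpoly)"
    by (simp add: mpoly_const_mult[symmetric])
  then have "mpoly_const (Fraction_Field.Fract (a * a') 1) * (h * h') =
      (mpoly_const (Fraction_Field.Fract a 1) * h) * (mpoly_const (Fraction_Field.Fract a' 1) * h')"
    by (simp add: ac_simps)
  also have "\<dots> = mpoly_to_fract (g * g')"
    by (simp only: * mpoly_to_fract_mult)
  finally show ?case using * by (metis mult_eq_0_iff)
qed

text \<open>Clearing denominators describes the horizontal prime inside \<open>R[T\<^sub>1, \<dots>, T\<^sub>n]\<close>.  All further arguments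
use this description instead of the fraction field.\<close>

lemma mem_horizontal_prime_iff:
  fixes fs :: "'n::finite \<Rightarrow> 'a::idom"
  shows "g \<in> horizontal_prime fs f \<longleftrightarrow>
    (\<exists>a k. a \<noteq> 0 \<and> mpoly_const a * g = k * forcing_poly fs f)"
proof
  let ?F = "forcing_poly fs f"
  assume "g \<in> horizontal_prime fs f"
  then obtain h where h: "mpoly_to_fract g = h * mpoly_to_fract ?F"
    by (auto simp: horizontal_prime_def genideal_singleton_ring_of_type)
  obtain a k where a: "a \<noteq> 0" "mpoly_const (Fraction_Field.Fract a 1) * h = mpoly_to_fract k"
    using clear_denominators[of h] by blast
  have "mpoly_to_fract (mpoly_const a * g) = mpoly_to_fract (k * ?F)"
    by (simp add: mpoly_to_fract_mult mpoly_to_fract_const h a(2)[symmetric] mult.assoc)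
  then have "mpoly_const a * g = k * ?F" by (rule injD[OF inj_mpoly_to_fract])
  then show "\<exists>a k. a \<noteq> 0 \<and> mpoly_const a * g = k * ?F" using a by blast
next
  let ?F = "forcing_poly fs f"
  assume "\<exists>a k. a \<noteq> 0 \<and> mpoly_const a * g = k * ?F"
  then obtain a k where a: "a \<noteq> 0" "mpoly_const a * g = k * ?F" by blast
  have "mpoly_const (Fraction_Field.Fract 1 a) * mpoly_const (Fraction_Field.Fract a 1) = (1 :: ('n, _) mpoly)"
    using a(1) by (simp add: mpoly_const_mult[symmetric] fract_collapse)
      (metis One_fract_def eq_fract(1) mpoly_const_1 mult.commute zero_neq_one)
  then have "mpoly_to_fract g =
      mpoly_const (Fraction_Field.Fract 1 a) * (mpoly_const (Fraction_Field.Fract a 1) * mpoly_to_fract g)"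
    by (simp add: mult.assoc[symmetric])
  also have "mpoly_const (Fraction_Field.Fract a 1) * mpoly_to_fract g = mpoly_to_fract k * mpoly_to_fract ?F"
    using a(2) by (metis mpoly_to_fract_const mpoly_to_fract_mult)
  finally show "g \<in> horizontal_prime fs f"
    unfolding horizontal_prime_def genideal_singleton_ring_of_type
    by (auto simp: mult.assoc[symmetric])
qed

lemma forcing_poly_in_horizontal_prime: "forcing_poly fs f \<in> horizontal_prime fs f"
  unfolding mem_horizontal_prime_iff by (intro exI[of _ 1]) simp

text \<open>A nonzero constant multiple of \<open>g\<close> is a multiple of \<open>F\<close> and still free of \<open>T\<^sub>i\<close>, hence zero.\<close>

lemma var_free_horizontal_prime_eq_0:
  assumes "fs i \<noteq> 0" "g \<in> horizontal_prime fs f" "g \<in> var_free i"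
  shows "g = 0"
proof -
  obtain a k where a: "a \<noteq> 0" "mpoly_const a * g = k * forcing_poly fs f"
    using assms(2) by (auto simp: mem_horizontal_prime_iff)
  have "mpoly_const a * g \<in> var_free i" using assms(3) by (intro var_free_mult var_free_const)
  then have "k = 0" using multiple_not_var_free[of fs i k f] assms(1) a by simp
  then have "mpoly_const a * g = 0" using a by simp
  then show "g = 0" using mpoly_mult_eq_0D a(1) by (metis mpoly_const_eq_0_iff)
qed

lemma horizontal_prime_ideal: "ideal (horizontal_prime fs f) ring_of_type_algebra"
proof -
  let ?F = "forcing_poly fs f"
  have "g + h \<in> horizontal_prime fs f"
    if gh: "g \<in> horizontal_prime fs f" "h \<in> horizontal_prime fs f" for g h
  proof -
    obtain a k b l where *: "a \<noteq> 0" "mpoly_const a * g = k * ?F" "b \<noteq> 0" "mpoly_const b * h = l * ?F"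
      using gh by (auto simp: mem_horizontal_prime_iff)
    have "mpoly_const (a * b) * (g + h) =
        mpoly_const b * (mpoly_const a * g) + mpoly_const a * (mpoly_const b * h)"
      by (simp add: mpoly_const_mult algebra_simps)
    also have "\<dots> = (mpoly_const b * k + mpoly_const a * l) * ?F"
      by (simp only: * distrib_right mult.assoc)
    finally show ?thesis using *(1,3) by (auto simp: mem_horizontal_prime_iff intro!: exI[of _ "a * b"])
  qed
  moreover have "r * g \<in> horizontal_prime fs f" if g: "g \<in> horizontal_prime fs f" for r g
  proof -
    obtain a k where *: "a \<noteq> 0" "mpoly_const a * g = k * ?F"
      using g by (auto simp: mem_horizontal_prime_iff)
    then have "mpoly_const a * (r * g) = (r * k) * ?F"
      by (metis mult.assoc mult.left_commute)
    then show ?thesis using * by (auto simp: mem_horizontal_prime_iff)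
  qed
  moreover have "0 \<in> horizontal_prime fs f"
    unfolding mem_horizontal_prime_iff by (intro exI[of _ 1] exI[of _ 0]) simp
  ultimately show ?thesis unfolding ideal_ring_of_type_iff by blast
qed

lemma horizontal_prime_pseudo_division:
  assumes "fs i \<noteq> 0" "g \<in> horizontal_prime fs f"
  shows "\<exists>N h. mpoly_const (fs i) ^ N * g = h * forcing_poly fs f"
proof -
  obtain N h where Nh: "mpoly_const (fs i) ^ N * g - h * forcing_poly fs f \<in> var_free i"
    using forcing_pseudo_division by blast
  have "mpoly_const (fs i) ^ N * g + (- h) * forcing_poly fs f \<in> horizontal_prime fs f"
    using horizontal_prime_ideal[of fs f] assms(2) forcing_poly_in_horizontal_prime[of fs f]
    unfolding ideal_ring_of_type_iff by blast
  then have "mpoly_const (fs i) ^ N * g - h * forcing_poly fs f = 0"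
    using Nh by (intro var_free_horizontal_prime_eq_0[where fs = fs and i = i and f = f] assms(1)) auto
  then show ?thesis by auto
qed

text \<open>Modulo \<open>F\<close> and up to powers of \<open>f\<^sub>i\<close>, the factors of a product in the horizontal prime may be
replaced by their pseudo-remainders \<open>?G\<close> and \<open>?H\<close>.  The product of these is free of \<open>T\<^sub>i\<close> and in the
horizontal prime, so it is zero, and one of the remainders vanishes.\<close>

lemma horizontal_prime_primeideal:
  assumes i: "fs i \<noteq> 0"
  shows "primeideal (horizontal_prime fs f) ring_of_type_algebra"
proof -
  let ?F = "forcing_poly fs f" and ?p = "horizontal_prime fs f" and ?c = "mpoly_const (fs i)"
  have p: "0 \<in> ?p" "\<And>x y. x \<in> ?p \<Longrightarrow> y \<in> ?p \<Longrightarrow> x + y \<in> ?p" "\<And>r x. x \<in> ?p \<Longrightarrow> r * x \<in> ?p"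
    using horizontal_prime_ideal[of fs f] by (auto simp: ideal_ring_of_type_iff)
  have "1 \<notin> ?p"
    using var_free_horizontal_prime_eq_0[of fs i 1 f] i var_free_const[of 1 i] by auto
  moreover have "g \<in> ?p \<or> h \<in> ?p" if gh: "g * h \<in> ?p" for g h
  proof -
    obtain N k where k: "?c ^ N * g - k * ?F \<in> var_free i"
      using forcing_pseudo_division by blast
    obtain M l where l: "?c ^ M * h - l * ?F \<in> var_free i"
      using forcing_pseudo_division by blast
    let ?G = "?c ^ N * g - k * ?F" and ?H = "?c ^ M * h - l * ?F"
    have "?G * ?H = (?c ^ N * ?c ^ M) * (g * h) + (k * l * ?F - ?c ^ N * g * l - ?c ^ M * h * k) * ?F"
      by (simp add: algebra_simps)
    also have "\<dots> \<in> ?p"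
      by (rule p(2)[OF p(3)[OF gh] p(3)[OF forcing_poly_in_horizontal_prime]])
    finally have "?G * ?H = 0"
      using k l by (intro var_free_horizontal_prime_eq_0[where fs = fs and i = i and f = f] i var_free_mult)
    then have "?G = 0 \<or> ?H = 0" by (rule mpoly_mult_eq_0D)
    then have "?c ^ N * g = k * ?F \<or> ?c ^ M * h = l * ?F" by auto
    then show ?thesis
      using i unfolding mem_horizontal_prime_iff mpoly_const_power[symmetric]
      by (metis power_not_zero)
  qed
  ultimately show ?thesis using p unfolding primeideal_ring_of_type_iff by blast
qed

lemma horizontal_prime_subset:
  assumes P: "primeideal P ring_of_type_algebra" "forcing_poly fs f \<in> P"
    and i: "mpoly_const (fs i) \<notin> P"
  shows "horizontal_prime fs f \<subseteq> P"
proof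
  fix g assume g: "g \<in> horizontal_prime fs f"
  have P': "0 \<in> P" "1 \<notin> P" "\<And>r x. x \<in> P \<Longrightarrow> r * x \<in> P" "\<And>x y. x * y \<in> P \<Longrightarrow> x \<in> P \<or> y \<in> P"
    using P(1) by (auto simp: primeideal_ring_of_type_iff)
  have "fs i \<noteq> 0" using i P'(1) by auto
  then obtain N h where "mpoly_const (fs i) ^ N * g = h * forcing_poly fs f"
    using horizontal_prime_pseudo_division g by blast
  then have "mpoly_const (fs i) ^ N * g \<in> P" using P'(3) P(2) by simp
  moreover have "mpoly_const (fs i) ^ N \<notin> P"
    using i P'(2,4) by (induction N) auto
  ultimately show "g \<in> P" using P'(4) by blast
qed

section \<open>The spectrum of the forcing algebra\<close>

text \<open>The prime ideal of \<open>R[T\<^sub>1, \<dots>, T\<^sub>n]\<close> that corresponds to a point of \<open>Spec A\<close>.\<close>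

definition residue_pullback ::
    "('n::finite \<Rightarrow> 'a::comm_ring_1) \<Rightarrow> 'a \<Rightarrow> ('n, 'a) mpoly set set \<Rightarrow> ('n, 'a) mpoly set" where
  "residue_pullback fs f \<PP> = {g. forcing_ideal fs f +>\<^bsub>ring_of_type_algebra\<^esub> g \<in> \<PP>}"

lemma forcing_zeros_eq:
  "forcing_zeros fs f S = {\<PP> \<in> Spec (forcing_algebra fs f). S \<subseteq> residue_pullback fs f \<PP>}"
  by (auto simp: forcing_zeros_def zeros_def residue_pullback_def)

lemma ideal_forcing_ideal: "ideal (forcing_ideal fs f) ring_of_type_algebra"
  unfolding forcing_ideal_def
  by (intro ring.genideal_ideal ring_from_type_algebra) simp

lemma mem_forcing_ideal_iff: "g \<in> forcing_ideal fs f \<longleftrightarrow> (\<exists>h. g = h * forcing_poly fs f)"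
  by (auto simp: forcing_ideal_def genideal_singleton_ring_of_type)

lemma carrier_forcing_algebra:
  "carrier (forcing_algebra fs f) = range (\<lambda>g. forcing_ideal fs f +>\<^bsub>ring_of_type_algebra\<^esub> g)"
  by (auto simp: forcing_algebra_def FactRing_def A_RCOSETS_def' a_r_coset_def')

text \<open>Every subset of \<open>A\<close> is the image of a set of polynomials, so the topology of \<open>Spec A\<close> can be described
by polynomials alone.\<close>

lemma closedin_forcing_iff:
  "closedin (zariski (forcing_algebra fs f)) C \<longleftrightarrow> (\<exists>S. C = forcing_zeros fs f S)"
proof
  assume "closedin (zariski (forcing_algebra fs f)) C"
  then obtain S where S: "S \<subseteq> carrier (forcing_algebra fs f)" "C = zeros (forcing_algebra fs f) S"
    by (auto simp: closedin_zariski)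
  then obtain S' where "S = (\<lambda>g. forcing_ideal fs f +>\<^bsub>ring_of_type_algebra\<^esub> g) ` S'"
    unfolding carrier_forcing_algebra by (auto simp: subset_image_iff)
  then show "\<exists>S. C = forcing_zeros fs f S"
    using S by (auto simp: forcing_zeros_def)
next
  assume "\<exists>S. C = forcing_zeros fs f S"
  then obtain S where "C = forcing_zeros fs f S" by blast
  then show "closedin (zariski (forcing_algebra fs f)) C"
    unfolding closedin_zariski carrier_forcing_algebra forcing_zeros_def
    by (intro exI[of _ "(\<lambda>g. forcing_ideal fs f +>\<^bsub>ring_of_type_algebra\<^esub> g) ` S"]) auto
qed

lemma primeideal_residue_pullback:
  assumes "\<PP> \<in> Spec (forcing_algebra fs f)"
  shows "primeideal (residue_pullback fs f \<PP>) ring_of_type_algebra"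
    and "forcing_poly fs f \<in> residue_pullback fs f \<PP>"
proof -
  interpret J: ideal "forcing_ideal fs f" ring_of_type_algebra by (rule ideal_forcing_ideal)
  have \<PP>: "primeideal \<PP> (ring_of_type_algebra Quot forcing_ideal fs f)"
    using assms by (simp add: Spec_def forcing_algebra_def)
  show "primeideal (residue_pullback fs f \<PP>) ring_of_type_algebra"
    using ring_hom_ring.primeideal_vimage[OF J.rcos_ring_hom_ring cring_from_type_algebra \<PP>]
    by (simp add: residue_pullback_def)
  have "forcing_poly fs f \<in> forcing_ideal fs f"
    unfolding mem_forcing_ideal_iff by (intro exI[of _ 1]) simp
  then have "forcing_ideal fs f +>\<^bsub>ring_of_type_algebra\<^esub> forcing_poly fs f = forcing_ideal fs f"
    by (rule J.a_rcos_const)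
  moreover have "forcing_ideal fs f \<in> \<PP>"
    using additive_subgroup.zero_closed[OF ideal.axioms(1)[OF primeideal.axioms(1)[OF \<PP>]]]
    by (simp add: FactRing_def)
  ultimately show "forcing_poly fs f \<in> residue_pullback fs f \<PP>"
    by (simp add: residue_pullback_def)
qed

text \<open>Because \<open>P\<close> contains \<open>F\<close>, a residue class modulo \<open>F\<close> lies either inside \<open>P\<close> or outside it.  Hence the
classes of the elements of \<open>P\<close> form a prime ideal of \<open>A\<close> whose pullback is \<open>P\<close> itself.\<close>

lemma residue_pullback_surj:
  assumes P: "primeideal P ring_of_type_algebra" "forcing_poly fs f \<in> P"
  shows "\<exists>\<PP> \<in> Spec (forcing_algebra fs f). residue_pullback fs f \<PP> = P"
proof
  let ?J = "forcing_ideal fs f"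
  let ?c = "\<lambda>g. ?J +>\<^bsub>ring_of_type_algebra\<^esub> g"
  have P': "1 \<notin> P" "\<And>x y. x \<in> P \<Longrightarrow> y \<in> P \<Longrightarrow> x + y \<in> P" "\<And>r x. x \<in> P \<Longrightarrow> r * x \<in> P"
      "\<And>x y. x * y \<in> P \<Longrightarrow> x \<in> P \<or> y \<in> P"
    using P(1) by (auto simp: primeideal_ring_of_type_iff)
  interpret J: ideal ?J ring_of_type_algebra by (rule ideal_forcing_ideal)
  have mem: "?c g \<in> ?c ` P \<longleftrightarrow> g \<in> P" for g
  proof
    assume "?c g \<in> ?c ` P"
    then obtain p where p: "p \<in> P" "?c g = ?c p" by blast
    have "g \<in> ?c g" by (rule J.a_rcos_self) simp
    then obtain h where "g = h * forcing_poly fs f + p"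
      unfolding p(2) by (auto simp: a_r_coset_def' mem_forcing_ideal_iff)
    then show "g \<in> P" using P' P(2) p(1) by blast
  qed blast
  then show "residue_pullback fs f (?c ` P) = P" by (auto simp: residue_pullback_def)
  have "primeideal (?c ` P) (forcing_algebra fs f)"
  proof (rule primeidealI)
    show "ideal (?c ` P) (forcing_algebra fs f)"
      unfolding forcing_algebra_def using primeideal.axioms(1)[OF P(1)]
      by (intro ring.ring_ideal_imp_quot_ideal ring_from_type_algebra ideal_forcing_ideal)
    show "cring (forcing_algebra fs f)"
      unfolding forcing_algebra_def by (intro J.quotient_is_cring cring_from_type_algebra)
    show "carrier (forcing_algebra fs f) \<noteq> ?c ` P"
      using mem[of 1] P'(1) unfolding carrier_forcing_algebra by blast
  next
    fix a b assume ab: "a \<in> carrier (forcing_algebra fs f)" "b \<in> carrier (forcing_algebra fs f)"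
      "a \<otimes>\<^bsub>forcing_algebra fs f\<^esub> b \<in> ?c ` P"
    obtain x y where xy: "a = ?c x" "b = ?c y"
      using ab by (auto simp: carrier_forcing_algebra)
    have "a \<otimes>\<^bsub>forcing_algebra fs f\<^esub> b = ?c (x \<otimes>\<^bsub>ring_of_type_algebra\<^esub> y)"
      unfolding xy forcing_algebra_def FactRing_def
      by (simp add: J.rcoset_mult_add)
    also have "x \<otimes>\<^bsub>ring_of_type_algebra\<^esub> y = x * y" by simp
    finally have "x * y \<in> P" using ab(3) mem by simp
    then show "a \<in> ?c ` P \<or> b \<in> ?c ` P" using P'(4) xy by blast
  qed
  then show "?c ` P \<in> Spec (forcing_algebra fs f)" by (simp add: Spec_def)
qed

text \<open>The point that corresponds to \<open>P\<close> is generic: a closed set that contains it contains all of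
\<open>V(P)\<close>.\<close>

lemma irreducible_forcing_zeros:
  assumes "primeideal P ring_of_type_algebra" "forcing_poly fs f \<in> P"
  shows "irreducible_in (zariski (forcing_algebra fs f)) (forcing_zeros fs f P)"
proof -
  obtain \<PP> where \<PP>: "\<PP> \<in> Spec (forcing_algebra fs f)" "residue_pullback fs f \<PP> = P"
    using residue_pullback_surj[OF assms] by blast
  then have "\<PP> \<in> forcing_zeros fs f P" by (simp add: forcing_zeros_eq)
  moreover have "forcing_zeros fs f P \<subseteq> C"
    if C: "closedin (zariski (forcing_algebra fs f)) C" "\<PP> \<in> C" for C
  proof -
    obtain S where "C = forcing_zeros fs f S" using C(1) by (auto simp: closedin_forcing_iff)
    then show ?thesis using C(2) \<PP> by (auto simp: forcing_zeros_eq)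
  qed
  moreover have "forcing_zeros fs f P \<subseteq> Spec (forcing_algebra fs f)"
    by (auto simp: forcing_zeros_eq)
  ultimately show ?thesis
    unfolding irreducible_in_def topspace_zariski by blast
qed

lemma primeideal_constants:
  assumes "primeideal P ring_of_type_algebra"
  shows "primeideal {a. mpoly_const a \<in> P} ring_of_type_algebra"
  using assms
  unfolding primeideal_ring_of_type_iff Ball_def mem_Collect_eq
    mpoly_const_0 mpoly_const_1 mpoly_const_add mpoly_const_mult
  by blast

lemma forcing_poly_mem_iff:
  assumes P: "primeideal P ring_of_type_algebra" and fs: "\<And>j. mpoly_const (fs j) \<in> P"
  shows "forcing_poly fs f \<in> P \<longleftrightarrow> mpoly_const f \<in> P"
proof -
  let ?L = "\<Sum>j\<in>UNIV. mpoly_const (fs j) * mpoly_var j"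
  have P': "0 \<in> P" "\<And>x y. x \<in> P \<Longrightarrow> y \<in> P \<Longrightarrow> x + y \<in> P" "\<And>r x. x \<in> P \<Longrightarrow> r * x \<in> P"
    using P by (auto simp: primeideal_ring_of_type_iff)
  have "mpoly_const (fs j) * mpoly_var j \<in> P" for j
    by (subst mult.commute) (rule P'(3)[OF fs])
  then have L: "?L \<in> P" by (intro sum_mem_additive P'(1,2)) auto
  then show ?thesis
    using P'(2)[OF L, of "mpoly_const f"] P'(2)[OF _ P'(3)[OF L, of "- 1"], of "forcing_poly fs f"]
    by (auto simp: forcing_poly_def)
qed

lemma mpoly_const_mem_extended_ideal:
  "0 \<in> Q \<Longrightarrow> a \<in> Q \<Longrightarrow> mpoly_const a \<in> extended_ideal Q"
  by (simp add: extended_ideal_def mpoly_const_def lookup_single when_def)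

lemma extended_ideal_subset_iff:
  assumes Q: "0 \<in> Q" and P: "primeideal P ring_of_type_algebra"
  shows "(extended_ideal Q :: ('n::finite, 'a::comm_ring_1) mpoly set) \<subseteq> P \<longleftrightarrow> mpoly_const ` Q \<subseteq> P"
proof
  assume "extended_ideal Q \<subseteq> P"
  then show "mpoly_const ` Q \<subseteq> P" using mpoly_const_mem_extended_ideal[of Q] Q by blast
next
  assume QP: "mpoly_const ` Q \<subseteq> P"
  have P': "0 \<in> P" "\<And>x y. x \<in> P \<Longrightarrow> y \<in> P \<Longrightarrow> x + y \<in> P" "\<And>r x. x \<in> P \<Longrightarrow> r * x \<in> P"
    using P by (auto simp: primeideal_ring_of_type_iff)
  show "extended_ideal Q \<subseteq> P"
  proof
    fix g :: "('n, 'a) mpoly" assume g: "g \<in> extended_ideal Q"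
    have "g = (\<Sum>m\<in>Poly_Mapping.keys g. Poly_Mapping.single m 1 * mpoly_const (Poly_Mapping.lookup g m))"
      by (rule poly_mapping_eqI)
        (auto simp: mpoly_const_def mult_single Poly_Mapping.lookup_sum lookup_single when_def in_keys_iff)
    also have "\<dots> \<in> P"
      using g QP by (intro sum_mem_additive P') (auto simp: extended_ideal_def)
    finally show "g \<in> P" .
  qed
qed

theorem corollary3p2:
  fixes fs :: "'n::finite \<Rightarrow> 'a::idom" and f :: 'a
  assumes "noetherian_ring (ring_of_type_algebra :: 'a ring)"
    and "krull_dim (ring_of_type_algebra :: 'a ring) = 1"
    and "genideal (ring_of_type_algebra :: 'a ring) (range fs) \<noteq> {0}"
  shows "connected_nonempty (zariski (forcing_algebra fs f)) \<longleftrightarrow>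
    (\<forall>V \<in> vertical_components fs f. horizontal_component fs f \<inter> V \<noteq> {})"
proof -
  let ?R = "ring_of_type_algebra :: 'a ring" and ?A = "forcing_algebra fs f"
  let ?F = "forcing_poly fs f"
  interpret R: cring ?R by (rule cring_from_type_algebra)
  have "\<exists>i. fs i \<noteq> 0"
  proof (rule ccontr)
    assume "\<not> (\<exists>i. fs i \<noteq> 0)"
    then have "range fs = {\<zero>\<^bsub>?R\<^esub>}" by auto
    then show False
      using assms(3) R.genideal_zero by simp
  qed
  then obtain i where i: "fs i \<noteq> 0" by blast

  define Z where "Z = insert f (range fs)"
  have "ideal (genideal ?R Z) ?R" by (rule R.genideal_ideal) simp
  from finite_primes_below[OF R.is_cring assms(1) this]
  obtain S where "finite S \<and> (\<forall>Q\<in>S. primeideal Q ?R \<and> genideal ?R Z \<subseteq> Q) \<and>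
    (\<forall>Q. primeideal Q ?R \<and> genideal ?R Z \<subseteq> Q \<longrightarrow> (\<exists>Q'\<in>S. Q' \<subseteq> Q))" ..
  then have "finite S" and S: "\<forall>Q\<in>S. primeideal Q ?R \<and> genideal ?R Z \<subseteq> Q"
    and below: "\<forall>Q. primeideal Q ?R \<and> genideal ?R Z \<subseteq> Q \<longrightarrow> (\<exists>Q'\<in>S. Q' \<subseteq> Q)"
    by blast+
  have Idl_subset: "genideal ?R Z \<subseteq> Q \<longleftrightarrow> Z \<subseteq> Q" if "primeideal Q ?R" for Q
  proof
    have "Z \<subseteq> genideal ?R Z" by (rule R.genideal_self) simp
    then show "Z \<subseteq> Q" if "genideal ?R Z \<subseteq> Q" using that by (rule subset_trans)
    show "genideal ?R Z \<subseteq> Q" if "Z \<subseteq> Q"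
      by (rule R.genideal_minimal[OF primeideal.axioms(1) that]) fact
  qed
  have S_prime: "primeideal Q ?R" if "Q \<in> S" for Q
    using that S by blast
  have S_Z: "Z \<subseteq> Q" if "Q \<in> S" for Q
    using that S Idl_subset[OF S_prime[OF that]] by blast
  \<comment> \<open>The members of \<open>S\<close> are nonzero since they contain \<open>f\<^sub>i\<close>, and so have no larger primes above them.\<close>
  have S_max: "Q = Q'" if "Q \<in> S" "primeideal Q' ?R" "Q \<subseteq> Q'" for Q Q'
  proof (rule krull_dim_1_prime_antichain[OF assms(2) domain_ring_of_type S_prime that(2) _ that(3)])
    have "fs i \<in> Q" using S_Z[OF that(1)] by (auto simp: Z_def)
    then show "Q \<noteq> {\<zero>\<^bsub>?R\<^esub>}" using i by auto
  qed (use that in auto)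

  \<comment> \<open>the closed sets \<open>V(\<qq> B)\<close>, indexed by the primes \<open>\<qq>\<close> over \<open>(f\<^sub>1, \<dots>, f\<^sub>n, f)\<close>\<close>
  define W :: "'a set \<Rightarrow> ('n, 'a) mpoly set set set" where
    "W Q = forcing_zeros fs f (extended_ideal Q)" for Q
  \<comment> \<open>A point of \<open>V(\<qq> B)\<close> determines \<open>\<qq>\<close> as its contraction to \<open>R\<close>; this makes these sets disjoint.\<close>
  have mem_W: "\<PP> \<in> W Q \<longleftrightarrow> \<PP> \<in> Spec ?A \<and> Q = {a. mpoly_const a \<in> residue_pullback fs f \<PP>}"
    if Q: "Q \<in> S" for \<PP> Q
  proof (cases "\<PP> \<in> Spec ?A")
    case True
    note pr = primeideal_residue_pullback(1)[OF True]
    have "0 \<in> Q" using S_prime[OF Q] by (simp add: primeideal_ring_of_type_iff)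
    then have "\<PP> \<in> W Q \<longleftrightarrow> Q \<subseteq> {a. mpoly_const a \<in> residue_pullback fs f \<PP>}"
      using True extended_ideal_subset_iff[OF _ pr] by (auto simp: W_def forcing_zeros_eq)
    also have "\<dots> \<longleftrightarrow> Q = {a. mpoly_const a \<in> residue_pullback fs f \<PP>}"
      using S_max[OF Q primeideal_constants[OF pr]] by blast
    finally show ?thesis using True by simp
  qed (simp add: W_def forcing_zeros_eq)

  have H_irr: "irreducible_in (zariski ?A) (horizontal_component fs f)"
    unfolding horizontal_component_def
    by (intro irreducible_forcing_zeros horizontal_prime_primeideal[where i = i] i
        forcing_poly_in_horizontal_prime)
  have H_closed: "closedin (zariski ?A) (horizontal_component fs f)"
    unfolding horizontal_component_def closedin_forcing_iff by blast
  have W_irr: "irreducible_in (zariski ?A) (W Q) \<and> closedin (zariski ?A) (W Q)" if Q: "Q \<in> S" for Q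
  proof
    have "0 \<in> Q" using S_prime[OF Q] by (simp add: primeideal_ring_of_type_iff)
    then have "mpoly_const a \<in> extended_ideal Q" if "a \<in> Z" for a
      using S_Z[OF Q] that by (intro mpoly_const_mem_extended_ideal) auto
    then have "?F \<in> extended_ideal Q"
      using forcing_poly_mem_iff[OF primeideal_extended_ideal[OF S_prime[OF Q]], of fs f]
      by (auto simp: Z_def)
    then show "irreducible_in (zariski ?A) (W Q)"
      unfolding W_def
      by (intro irreducible_forcing_zeros primeideal_extended_ideal S_prime Q)
    show "closedin (zariski ?A) (W Q)" unfolding W_def closedin_forcing_iff by blast
  qed
  have cover: "topspace (zariski ?A) = horizontal_component fs f \<union> \<Union>(W ` S)"
  proof
    show "topspace (zariski ?A) \<subseteq> horizontal_component fs f \<union> \<Union>(W ` S)"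
    proof
      fix \<PP> assume "\<PP> \<in> topspace (zariski ?A)"
      then have \<PP>: "\<PP> \<in> Spec ?A" by (simp add: topspace_zariski)
      let ?P = "residue_pullback fs f \<PP>"
      note pr = primeideal_residue_pullback[OF \<PP>]
      show "\<PP> \<in> horizontal_component fs f \<union> \<Union>(W ` S)"
      proof (cases "\<forall>j. mpoly_const (fs j) \<in> ?P")
        case False
        then have "horizontal_prime fs f \<subseteq> ?P" using horizontal_prime_subset[OF pr] by blast
        then show ?thesis using \<PP> by (auto simp: horizontal_component_def forcing_zeros_eq)
      next
        case True
        then have "mpoly_const f \<in> ?P" using forcing_poly_mem_iff[OF pr(1)] pr(2) by blast
        then have "Z \<subseteq> {a. mpoly_const a \<in> ?P}" using True by (auto simp: Z_def)
        then obtain Q where Q: "Q \<in> S" "Q \<subseteq> {a. mpoly_const a \<in> ?P}"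
          using below Idl_subset[OF primeideal_constants[OF pr(1)]] primeideal_constants[OF pr(1)]
          by blast
        then have "\<PP> \<in> W Q" using mem_W[OF Q(1)] S_max primeideal_constants[OF pr(1)] \<PP> by blast
        then show ?thesis using Q by blast
      qed
    qed
  qed (auto simp: topspace_zariski W_def horizontal_component_def forcing_zeros_eq)
  show ?thesis
    unfolding vertical_components_def
  proof (rule connected_iff_components_meet[OF H_irr H_closed _ _ _ cover])
    show "finite (W ` S)" using \<open>finite S\<close> by simp
  next
    fix V assume "V \<in> W ` S"
    then show "irreducible_in (zariski ?A) V \<and> closedin (zariski ?A) V" using W_irr by blast
  next
    fix V V' assume "V \<in> W ` S" "V' \<in> W ` S" "V \<noteq> V'"
    then show "V \<inter> V' = {}" using mem_W by blast
  qed
qed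

end
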